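(* Let $\{\mu_t\}_{t=1}^T \subset \Delta_{N-1}$ be topics satisfying the anchor words property $(\mathcal{AW})$. Suppose documents $d_1, d_2, \ldots$ are generated independently by the generative pLSA model over $\{\mu_t\}_{t=1}^T$, where the topic weights $\theta_d$ are sampled independently for each document from a fixed probability distribution $\mathcal{T}$ on $\Delta_{T-1}$ whose expected topic-topic co-occurrence matrix $\Theta_{i,j} = \mathbb{E}\,\theta_d(i)\theta_d(j)$ ($i,j \le T$) has full rank $T$. Set $$M_{u,v} := \sum_{i,j=1}^T \Theta_{i,j}\, \mu_i(u)\mu_j(v), \qquad u,v \in \{1,\ldots,N\},$$ and let $\widehat{M} = \widehat{M}^{(D)}$ be the empirical co-occurrence matrix of the first $D$ documents. Then, with probability $1$, $$\lim_{D\to\infty} \sum_{u,v} \widehat{M}_{u,v} \log M_{u,v} = \sum_{u,v} M_{u,v}\log M_{u,v}.$$ Conversely, let $\{\mu'_t\}_{t=1}^T \subset \Delta_{N-1}$ be a set of topics satisfying $(\mathcal{AW})$ with $\{\mu'_t\}_{t=1}^T \neq \{\mu_t\}_{t=1}^T$ (as sets). Then there is a constant $\gamma = \gamma\big(\{\mu_t\}_{t=1}^T, \{\mu'_t\}_{t=1}^T, \kappa(\Theta)\big) > 0$ (depending only on the two sets of topics and on $\kappa(\Theta)$) such that for any FDM $M'$ over $\{\mu'_t\}_{t=1}^T$, with probability $1$, $$\lim_{D\to\infty} \sum_{u,v} \widehat{M}_{u,v}\log M'_{u,v} \le \sum_{u,v} M_{u,v}\log M_{u,v} - \gamma.$$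
   Context: Let $N$ be the dictionary size, with tokens $\{1,\ldots,N\}$; let $\Delta_{N-1}$ and $\Delta_{T-1}$ denote the probability simplices in $\mathbb{R}^N$ and $\mathbb{R}^T$. A topic is an element of $\Delta_{N-1}$, i.e. a probability distribution on tokens. Anchor words property $(\mathcal{AW})$: for every $t\le T$ there is a token $u_t \in\{1,\ldots,N\}$ such that $\mu_t(u_t) > 0$ and $\mu_{t'}(u_t) = 0$ for all $t' \ne t$. FDM (full dependence mixture) over topics $\{\mu_t\}_{t=1}^T$: an $N\times N$ matrix of the form $\sum_{i,j=1}^T \alpha_{i,j}\mu_i(u)\mu_j(v)$ with $\alpha_{i,j}\ge 0$, $\alpha_{i,j}=\alpha_{j,i}$, $\sum_{i,j}\alpha_{i,j}=1$. Generative pLSA model: independently for each document $d$, draw $\theta_d \in \Delta_{T-1}$ from $\mathcal{T}$; conditionally on $\theta_d$, the document consists of $l_d$ tokens drawn i.i.d. from the mixture $\nu_d = \sum_{t=1}^T \theta_d(t)\mu_t$. The document lengths $l_d \ge 2$ are fixed integers. Empirical co-occurrence matrix: for a document $d$ with tokens $x_1,\ldots,x_{l_d}$, let $c_d(u) = \#\{i : x_i = u\}$ and $$(\widehat{M}_d)_{u,v} = \frac{l_d}{l_d-1}\,\frac{c_d(u)}{l_d}\,\frac{c_d(v)}{l_d} \ \text{ if } u\neq v, \qquad (\widehat{M}_d)_{u,u} = \frac{l_d}{l_d-1}\,\frac{c_d(u)^2}{l_d^2} - \frac{c_d(u)}{l_d(l_d-1)}.$$ For $D$ documents $d_1,\ldots,d_D$,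 $\widehat{M} = \widehat{M}^{(D)} = \frac1D\sum_{k=1}^D \widehat{M}_{d_k}$. $\kappa(\Theta)$ denotes the smallest singular value of $\Theta$ (positive exactly when $\Theta$ has full rank). Conventions: $0\log 0 = 0$ (also $0\cdot\log 0 = 0$ when the two zeros come from different matrices), and $c \log 0 = -\infty$ for $c>0$; limits are taken in $[-\infty,\infty)$. *)

theory Defs
  imports "HOL-Probability.Probability"
begin

text \<open>
  Tokens are the elements of a finite type \<open>'n\<close> (so \<open>N = CARD('n)\<close>), topic indices those of a
  finite type \<open>'t\<close> (so \<open>T = CARD('t)\<close>).
\<close>

definition prob_simplex :: "(real^'a::finite) set" where
  "prob_simplex = {p. (\<forall>i. 0 \<le> p $ i) \<and> (\<Sum>i\<in>UNIV. p $ i) = 1}"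

definition anchor_words :: "('t::finite \<Rightarrow> real^'n::finite) \<Rightarrow> bool" where
  "anchor_words \<mu> \<longleftrightarrow> (\<forall>t. \<exists>u. \<mu> t $ u > 0 \<and> (\<forall>t'. t' \<noteq> t \<longrightarrow> \<mu> t' $ u = 0))"

definition topic_mixture_matrix ::
    "('t::finite \<Rightarrow> real^'n::finite) \<Rightarrow> real^'t^'t \<Rightarrow> real^'n^'n" where
  "topic_mixture_matrix \<mu> \<alpha> = (\<chi> u v. \<Sum>i\<in>UNIV. \<Sum>j\<in>UNIV. \<alpha> $ i $ j * \<mu> i $ u * \<mu> j $ v)"

definition is_FDM :: "('t::finite \<Rightarrow> real^'n::finite) \<Rightarrow> real^'n^'n \<Rightarrow> bool" where
  "is_FDM \<mu> M \<longleftrightarrow> (\<exists>\<alpha>.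
      (\<forall>i j. 0 \<le> \<alpha> $ i $ j) \<and> (\<forall>i j. \<alpha> $ i $ j = \<alpha> $ j $ i) \<and>
      (\<Sum>i\<in>UNIV. \<Sum>j\<in>UNIV. \<alpha> $ i $ j) = 1 \<and> M = topic_mixture_matrix \<mu> \<alpha>)"

definition singular_values :: "real^'n::finite^'m::finite \<Rightarrow> real set" where
  "singular_values A = {s. 0 \<le> s \<and> (\<exists>x. x \<noteq> 0 \<and> (transpose A ** A) *v x = s\<^sup>2 *s x)}"

definition smallest_singular_value :: "real^'n::finite^'m::finite \<Rightarrow> real" where
  "smallest_singular_value A = (LEAST s. s \<in> singular_values A)"

text \<open>Probability distributions on the simplex: the underlying space is the simplex itself.\<close>

definition weight_distribution :: "(real^'t::finite) measure \<Rightarrow> bool" where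
  "weight_distribution \<T> \<longleftrightarrow>
     prob_space \<T> \<and> sets \<T> = sets (restrict_space borel prob_simplex)"

definition topic_cooccurrence :: "(real^'t::finite) measure \<Rightarrow> real^'t^'t" where
  "topic_cooccurrence \<T> = (\<chi> i j. \<integral>\<theta>. \<theta> $ i * \<theta> $ j \<partial>\<T>)"

definition token_pmf :: "('t::finite \<Rightarrow> real^'n::finite) \<Rightarrow> real^'t \<Rightarrow> 'n pmf" where
  "token_pmf \<mu> \<theta> = embed_pmf (\<lambda>u. \<Sum>t\<in>UNIV. \<theta> $ t * \<mu> t $ u)"

text \<open>
  A document is the list of its tokens.  Its law is obtained by drawing \<open>\<theta>\<close> from \<open>\<T>\<close> and then, given
  \<open>\<theta>\<close>, drawing \<open>l\<close> independent tokens from the mixture.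
\<close>

definition document_law ::
    "('t::finite \<Rightarrow> real^'n::finite) \<Rightarrow> (real^'t) measure \<Rightarrow> nat \<Rightarrow> 'n list measure" where
  "document_law \<mu> \<T> l = \<T> \<bind> (\<lambda>\<theta>. measure_pmf (replicate_pmf l (token_pmf \<mu> \<theta>)))"

text \<open>
  The joint law of the whole sequence of independent documents, document \<open>d\<close> having length \<open>l d\<close>.
  An almost sure statement about the documents is a statement about this law; see
  \<open>AE_corpus_law_realization\<close> below for documents living on some other probability space.
\<close>

definition corpus_law ::
    "('t::finite \<Rightarrow> real^'n::finite) \<Rightarrow> (real^'t) measure \<Rightarrow> (nat \<Rightarrow> nat) \<Rightarrow> (nat \<Rightarrow> 'n list) measure"
  where
  "corpus_law \<mu> \<T> l = (\<Pi>\<^sub>M d\<in>UNIV. document_law \<mu> \<T> (l d))"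

definition doc_matrix :: "'n::finite list \<Rightarrow> real^'n^'n" where
  "doc_matrix xs = (\<chi> u v.
     let l = real (length xs); c = (\<lambda>w. real (count_list xs w)) in
     if u \<noteq> v then l / (l - 1) * (c u / l) * (c v / l)
     else l / (l - 1) * ((c u)\<^sup>2 / l\<^sup>2) - c u / (l * (l - 1)))"

definition empirical_matrix :: "(nat \<Rightarrow> 'n::finite list) \<Rightarrow> nat \<Rightarrow> real^'n^'n" where
  "empirical_matrix docs D = (1 / real D) *\<^sub>R (\<Sum>d<D. doc_matrix (docs d))"

text \<open>\<open>c log x\<close> for \<open>c, x \<ge> 0\<close>, with \<open>0 log 0 = 0\<close> and \<open>c log 0 = -\<infinity>\<close> for \<open>c > 0\<close>.\<close>

definition mult_log :: "real \<Rightarrow> real \<Rightarrow> ereal" where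
  "mult_log c x = (if c = 0 then 0 else if x = 0 then -\<infinity> else ereal (c * ln x))"

definition log_score :: "real^'n::finite^'n \<Rightarrow> real^'n^'n \<Rightarrow> ereal" where
  "log_score A B = (\<Sum>u\<in>UNIV. \<Sum>v\<in>UNIV. mult_log (A $ u $ v) (B $ u $ v))"


text \<open>
  For \<open>\<theta>\<close> in the simplex the mixture weights do form a probability mass function, and the kernel in
  \<open>document_law\<close> is measurable, so that neither \<open>embed_pmf\<close> nor \<open>bind\<close> is used outside its domain.
\<close>

lemma pmf_token_pmf:
  assumes "range \<mu> \<subseteq> prob_simplex" "\<theta> \<in> prob_simplex"
  shows "pmf (token_pmf \<mu> \<theta>) u = (\<Sum>t\<in>UNIV. \<theta> $ t * \<mu> t $ u)"
proof -
  have nn: "0 \<le> (\<Sum>t\<in>UNIV. \<theta> $ t * \<mu> t $ u)" for u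
    using assms by (intro sum_nonneg mult_nonneg_nonneg) (auto simp: prob_simplex_def)
  have mu: "(\<Sum>u\<in>UNIV. \<mu> t $ u) = 1" for t
    using assms by (auto simp: prob_simplex_def)
  have "(\<Sum>u\<in>UNIV. \<Sum>t\<in>UNIV. \<theta> $ t * \<mu> t $ u) = (\<Sum>t\<in>UNIV. \<theta> $ t * (\<Sum>u\<in>UNIV. \<mu> t $ u))"
    by (subst sum.swap) (simp add: sum_distrib_left)
  also have "\<dots> = 1"
    using assms by (simp add: mu prob_simplex_def)
  finally have "(\<integral>\<^sup>+u. ennreal (\<Sum>t\<in>UNIV. \<theta> $ t * \<mu> t $ u) \<partial>count_space UNIV) = 1"
    by (simp add: nn_integral_count_space_finite sum_ennreal nn)
  then show ?thesis
    unfolding token_pmf_def by (intro pmf_embed_pmf nn)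
qed

lemma pmf_replicate_pmf:
  "pmf (replicate_pmf n p) xs = (if length xs = n then prod_list (map (pmf p) xs) else 0)"
proof (induction n arbitrary: xs)
  case 0
  then show ?case by (auto simp: indicator_def)
next
  case (Suc n)
  show ?case
  proof (cases xs)
    case Nil
    then show ?thesis by (simp add: pmf_eq_0_set_pmf)
  next
    case (Cons y ys)
    have "replicate_pmf (Suc n) p = map_pmf (\<lambda>(x, xs). x # xs) (pair_pmf p (replicate_pmf n p))"
      by (simp add: pair_pmf_def map_bind_pmf)
    moreover have "inj (\<lambda>(x :: 'a, xs). x # xs)"
      by (auto simp: inj_def)
    ultimately have "pmf (replicate_pmf (Suc n) p) (y # ys) = pmf p y * pmf (replicate_pmf n p) ys"
      using pmf_map_inj'[of "\<lambda>(x :: 'a, xs). x # xs" "pair_pmf p (replicate_pmf n p)" "(y, ys)"]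
      by (simp add: pmf_pair)
    then show ?thesis using Suc Cons by simp
  qed
qed

lemma space_weight_distribution:
  "weight_distribution \<T> \<Longrightarrow> space \<T> = prob_simplex"
  by (metis weight_distribution_def sets_eq_imp_space_eq space_restrict_space space_borel
      Int_UNIV_right)

lemma measurable_document_kernel:
  assumes "range \<mu> \<subseteq> prob_simplex" "weight_distribution \<T>"
  shows "(\<lambda>\<theta>. measure_pmf (replicate_pmf l (token_pmf \<mu> \<theta>)))
           \<in> measurable \<T> (subprob_algebra (count_space UNIV))"
proof (rule measurable_subprob_algebra)
  fix A :: "'a list set"
  have sp: "space \<T> = prob_simplex"
    using assms(2) by (rule space_weight_distribution)
  have [measurable]: "(\<lambda>\<theta>. \<theta> $ t) \<in> borel_measurable \<T>" for t
  proof -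
    have "(\<lambda>\<theta> :: real^'b. \<theta> $ t) \<in> borel_measurable (restrict_space borel prob_simplex)"
      by (intro measurable_restrict_space1 borel_measurable_continuous_onI continuous_intros)
    then show ?thesis
      using assms(2) measurable_cong_sets[of \<T> "restrict_space borel prob_simplex" borel borel]
      by (auto simp: weight_distribution_def)
  qed
  have 1: "(\<lambda>\<theta>. pmf (token_pmf \<mu> \<theta>) u) \<in> borel_measurable \<T>" for u
    by (subst measurable_cong[OF pmf_token_pmf]) (auto simp: sp assms(1))
  have "(\<lambda>\<theta>. prod_list (map (pmf (token_pmf \<mu> \<theta>)) xs)) \<in> borel_measurable \<T>" for xs
    by (induction xs) (auto intro!: borel_measurable_times 1)
  then have 2: "(\<lambda>\<theta>. pmf (replicate_pmf l (token_pmf \<mu> \<theta>)) xs) \<in> borel_measurable \<T>" for xs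
    by (simp add: pmf_replicate_pmf)
  have "emeasure (measure_pmf p) A = (\<Sum>i. ennreal (if from_nat i \<in> A \<and> to_nat (from_nat i :: 'a list) = i
           then pmf p (from_nat i) else 0))" for p :: "'a list pmf"
  proof -
    have "emeasure (measure_pmf p) A = (\<integral>\<^sup>+x. ennreal (pmf p x) * indicator A x \<partial>count_space UNIV)"
      by (simp add: nn_integral_pmf[symmetric] nn_integral_count_space_indicator)
    also have "\<dots> = (\<integral>\<^sup>+x. ennreal (pmf p x) * indicator A x \<partial>count_space (from_nat ` range (to_nat :: 'a list \<Rightarrow> nat)))"
      by (simp add: image_image)
    also have "\<dots> = (\<integral>\<^sup>+i. ennreal (pmf p (from_nat i)) * indicator A (from_nat i)
                       \<partial>count_space (range (to_nat :: 'a list \<Rightarrow> nat)))"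
      by (rule nn_integral_bij_count_space[symmetric]) (auto simp: bij_betw_def inj_on_def)
    also have "\<dots> = (\<integral>\<^sup>+i. ennreal (if from_nat i \<in> A \<and> to_nat (from_nat i :: 'a list) = i
           then pmf p (from_nat i) else 0) \<partial>count_space UNIV)"
      by (subst nn_integral_count_space_indicator)
         (auto intro!: nn_integral_cong simp: indicator_def, metis rangeI)
    finally show ?thesis by (simp add: nn_integral_count_space_nat)
  qed
  then show "(\<lambda>\<theta>. emeasure (measure_pmf (replicate_pmf l (token_pmf \<mu> \<theta>))) A) \<in> borel_measurable \<T>"
    using 2 by simp
qed (auto simp: measure_pmf.subprob_space_axioms)

lemma
  assumes "range \<mu> \<subseteq> prob_simplex" "weight_distribution \<T>"
  shows sets_document_law: "sets (document_law \<mu> \<T> l) = UNIV"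
    and prob_space_document_law: "prob_space (document_law \<mu> \<T> l)"
proof -
  have pr: "prob_space \<T>" using assms(2) by (simp add: weight_distribution_def)
  then have ne: "space \<T> \<noteq> {}" by (rule prob_space.not_empty)
  show "sets (document_law \<mu> \<T> l) = UNIV"
    unfolding document_law_def by (subst sets_bind[where N = "count_space UNIV"]) (auto simp: ne)
  show "prob_space (document_law \<mu> \<T> l)"
    unfolding document_law_def
    by (rule prob_space.prob_space_bind[OF pr _ measurable_document_kernel[OF assms]])
       (simp add: measure_pmf.prob_space_axioms)
qed

lemma AE_corpus_law_realization:
  fixes X :: "nat \<Rightarrow> 'w \<Rightarrow> 'n::finite list"
  assumes "prob_space P"
    and "prob_space.indep_vars P (\<lambda>_. count_space UNIV) X UNIV"
    and "\<And>d. distr P (count_space UNIV) (X d) = document_law \<mu> \<T> (l d)"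
    and "AE docs in corpus_law \<mu> \<T> l. Q docs"
  shows "AE \<omega> in P. Q (\<lambda>d. X d \<omega>)"
proof -
  interpret prob_space P by fact
  have rv: "random_variable (count_space UNIV) (X d)" for d
    using assms(2) by (auto simp: indep_vars_def)
  have "distr P (\<Pi>\<^sub>M d\<in>UNIV. count_space UNIV) (\<lambda>\<omega>. \<lambda>d\<in>UNIV. X d \<omega>) = corpus_law \<mu> \<T> l"
    using assms(2) indep_vars_iff_distr_eq_PiM[where I = UNIV and M' = "\<lambda>_. count_space UNIV" and X = X] rv
    by (simp add: corpus_law_def assms(3))
  then have "distr P (\<Pi>\<^sub>M d\<in>UNIV. count_space UNIV) (\<lambda>\<omega> d. X d \<omega>) = corpus_law \<mu> \<T> l"
    by (simp add: restrict_def)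
  moreover have "(\<lambda>\<omega> d. X d \<omega>) \<in> measurable P (\<Pi>\<^sub>M d\<in>UNIV. count_space UNIV)"
    using measurable_restrict[where I = UNIV, OF rv] by (simp add: restrict_def)
  ultimately show ?thesis
    using assms(4) by (metis AE_distrD)
qed

end

theory Submission
  imports Defs
begin

text \<open>
  The entries of the document matrices lie in \<open>[0, 1]\<close> and have mean \<open>M\<close>, so Hoeffding's inequality and
  Borel--Cantelli give almost sure convergence of the empirical matrix to \<open>M\<close>. Entries of mean zero
  vanish almost surely, so the score against any \<open>B\<close> converges to \<open>\<Sum> M log B\<close>, which may be \<open>-\<infinity>\<close>.
  The loss of \<open>B\<close> against \<open>M\<close> is a Kullback--Leibler divergence, hence at least the squared Hellinger
  distance. That distance is positive when \<open>M\<close> and \<open>B\<close> have different topics: the row space of \<open>M\<close>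
  is the span of its topics, and by the anchor words these are the vertices of the polytope in which
  the span meets the simplex. The positive lower bound \<open>\<gamma>\<close> comes from compactness of the set of
  weight matrices whose smallest singular value is at least \<open>\<kappa>\<close>.
\<close>

subsection \<open>The log-score\<close>

text \<open>Addition on \<open>ereal\<close> is discontinuous only where opposite infinities meet.
  Barring \<open>\<infinity>\<close> as a limit excludes this, while \<open>-\<infinity>\<close>
  stays admissible, as scores require.\<close>

lemma tendsto_sum_ereal_not_PInf:
  fixes f :: "'a \<Rightarrow> 'b \<Rightarrow> ereal"
  assumes "\<And>i. i \<in> S \<Longrightarrow> (f i \<longlongrightarrow> a i) F" "\<And>i. i \<in> S \<Longrightarrow> a i \<noteq> \<infinity>"
  shows "((\<lambda>x. \<Sum>i\<in>S. f i x) \<longlongrightarrow> (\<Sum>i\<in>S. a i)) F"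
  using assms
proof (induction S rule: infinite_finite_induct)
  case (insert i S)
  have "(\<Sum>i\<in>S. a i) \<noteq> \<infinity>"
    using insert by (auto simp: sum_Pinfty)
  then have "((\<lambda>x. f i x + (\<Sum>i\<in>S. f i x)) \<longlongrightarrow> a i + (\<Sum>i\<in>S. a i)) F"
    using insert by (intro tendsto_add_ereal_general) auto
  then show ?case using insert by simp
qed auto

lemma mult_log_not_PInf: "mult_log c x \<noteq> \<infinity>"
  by (simp add: mult_log_def)

text \<open>For \<open>x = 0\<close> the value jumps from \<open>-\<infinity>\<close> to 0 as the
  weight reaches 0, so a zero limit has to be attained identically. A nonzero limit keeps
  \<open>X n\<close> eventually off that branch.\<close>

lemma tendsto_mult_log:
  assumes "X \<longlonglongrightarrow> c" "c = 0 \<Longrightarrow> \<forall>n. X n = 0"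
  shows "(\<lambda>n. mult_log (X n) x) \<longlonglongrightarrow> mult_log c x"
proof (cases "c = 0")
  case True
  then show ?thesis using assms by (simp add: mult_log_def)
next
  case False
  have ev: "\<forall>\<^sub>F n in sequentially. X n \<noteq> 0"
    using tendsto_imp_eventually_ne[OF assms(1) False] .
  have "(\<lambda>n. if x = 0 then -\<infinity> else ereal (X n * ln x)) \<longlonglongrightarrow> mult_log c x"
    using assms(1) False by (auto simp: mult_log_def intro!: tendsto_intros)
  moreover have "\<forall>\<^sub>F n in sequentially. (if x = 0 then -\<infinity> else ereal (X n * ln x)) = mult_log (X n) x"
    using ev by eventually_elim (simp add: mult_log_def)
  ultimately show ?thesis
    by (rule Lim_transform_eventually)
qed

lemma tendsto_log_score:
  assumes "\<And>u v. (\<lambda>n. X n $ u $ v) \<longlonglongrightarrow> A $ u $ v"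
    and "\<And>u v. A $ u $ v = 0 \<Longrightarrow> \<forall>n. X n $ u $ v = 0"
  shows "(\<lambda>n. log_score (X n) B) \<longlonglongrightarrow> log_score A B"
  unfolding log_score_def
  by (intro tendsto_sum_ereal_not_PInf tendsto_mult_log assms) (auto simp: sum_Pinfty mult_log_not_PInf)

section \<open>Information loss and the Hellinger distance\<close>

definition hellinger :: "real^'n::finite^'n \<Rightarrow> real^'n^'n \<Rightarrow> real" where
  "hellinger A B = (\<Sum>u\<in>UNIV. \<Sum>v\<in>UNIV. (sqrt (A $ u $ v) - sqrt (B $ u $ v))\<^sup>2)"

text \<open>The bound is \<open>ln y \<le> y - 1\<close> at \<open>y = sqrt (q / p)\<close>.\<close>

lemma mult_log_le:
  assumes "0 \<le> p" "0 \<le> q"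
  shows "mult_log p q \<le> ereal (p * ln p + (2 * sqrt p * sqrt q - 2 * p))"
proof (cases "p = 0 \<or> q = 0")
  case True
  then show ?thesis by (auto simp: mult_log_def)
next
  case False
  then have pq: "0 < p" "0 < q" using assms by auto
  define r where "r = sqrt q / sqrt p"
  have r: "sqrt (q / p) = r" "sqrt q = r * sqrt p"
    using pq by (simp_all add: r_def real_sqrt_divide)
  have "ln (sqrt (q / p)) \<le> r - 1"
    unfolding r using pq by (intro ln_le_minus_one) (simp add: r_def)
  then have "ln q - ln p \<le> 2 * (r - 1)"
    using pq by (simp add: ln_sqrt ln_div)
  then have "p * (ln q - ln p) \<le> p * (2 * (r - 1))"
    using pq by (intro mult_left_mono) auto
  also have "\<dots> = 2 * sqrt p * sqrt q - 2 * p"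
  proof -
    have "sqrt p * sqrt q = p * r"
      using pq by (simp add: r(2))
    then show ?thesis by (simp add: right_diff_distrib mult.assoc)
  qed
  finally show ?thesis
    using pq by (simp add: mult_log_def algebra_simps)
qed

text \<open>Summing \<open>mult_log_le\<close> leaves the total of
  \<open>2 * sqrt a * sqrt b - 2 * a\<close>. As both matrices have mass 1, this is minus the
  expanded sum of squares.\<close>

lemma log_score_le:
  assumes A: "\<And>u v. 0 \<le> A $ u $ v" "(\<Sum>u\<in>UNIV. \<Sum>v\<in>UNIV. A $ u $ v) = 1"
    and B: "\<And>u v. 0 \<le> B $ u $ v" "(\<Sum>u\<in>UNIV. \<Sum>v\<in>UNIV. B $ u $ v) = 1"
  shows "log_score A B \<le> log_score A A - ereal (hellinger A B)"
proof -
  \<comment> \<open>The self-score is finite: a zero entry is paired with itself and contributes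
    0.\<close>
  have AA: "log_score A A = ereal (\<Sum>u\<in>UNIV. \<Sum>v\<in>UNIV. A $ u $ v * ln (A $ u $ v))"
    unfolding log_score_def sum_ereal[symmetric] by (intro sum.cong refl) (simp add: mult_log_def)
  have "log_score A B \<le> (\<Sum>u\<in>UNIV. \<Sum>v\<in>UNIV. ereal (A $ u $ v * ln (A $ u $ v)
      + (2 * sqrt (A $ u $ v) * sqrt (B $ u $ v) - 2 * A $ u $ v)))"
    unfolding log_score_def by (intro sum_mono mult_log_le A B)
  also have "\<dots> = log_score A A
      + ereal (\<Sum>u\<in>UNIV. \<Sum>v\<in>UNIV. 2 * sqrt (A $ u $ v) * sqrt (B $ u $ v) - 2 * A $ u $ v)"
    by (simp add: AA sum.distrib)
  also have "(\<Sum>u\<in>UNIV. \<Sum>v\<in>UNIV. 2 * sqrt (A $ u $ v) * sqrt (B $ u $ v) - 2 * A $ u $ v)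
      = - hellinger A B"
  proof -
    have "hellinger A B = (\<Sum>u\<in>UNIV. \<Sum>v\<in>UNIV. A $ u $ v + B $ u $ v - 2 * sqrt (A $ u $ v) * sqrt (B $ u $ v))"
      unfolding hellinger_def by (simp add: power2_diff A B)
    then show ?thesis
      using A(2) B(2) by (simp add: sum.distrib sum_subtractf flip: sum_distrib_left)
  qed
  finally show ?thesis
    by (simp add: AA)
qed

subsection \<open>Identifiability\<close>

lemma coordinate_zero_on_span:
  assumes "\<And>x. x \<in> S \<Longrightarrow> x $ u = (0::real)" "x \<in> span S"
  shows "x $ u = 0"
  using assms(2) by (induction rule: span_induct_alt) (auto simp: assms(1))

text \<open>Vanishing is given by vector and by index: sums over \<open>range \<mu>\<close> use the
  former, sums over the index type the latter.\<close>

lemma anchor_wordsE: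
  fixes \<mu> :: "'t::finite \<Rightarrow> real^'n::finite"
  assumes "anchor_words \<mu>"
  obtains u where "\<mu> t $ u > 0" "\<And>t'. \<mu> t' \<noteq> \<mu> t \<Longrightarrow> \<mu> t' $ u = 0" "\<And>t'. t' \<noteq> t \<Longrightarrow> \<mu> t' $ u = 0"
  using assms unfolding anchor_words_def by metis

text \<open>The anchor coordinate of a topic vanishes on all other topics, hence on their span, but
  not on the topic itself.\<close>

lemma independent_anchor_words:
  fixes \<mu> :: "'t::finite \<Rightarrow> real^'n::finite"
  assumes "anchor_words \<mu>"
  shows "independent (range \<mu>)"
proof
  assume "dependent (range \<mu>)"
  then obtain t where t: "\<mu> t \<in> span (range \<mu> - {\<mu> t})"
    by (auto simp: dependent_def)
  obtain u where u: "\<mu> t $ u > 0" "\<And>t'. \<mu> t' \<noteq> \<mu> t \<Longrightarrow> \<mu> t' $ u = 0"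
        "\<And>t'. t' \<noteq> t \<Longrightarrow> \<mu> t' $ u = 0"
    using anchor_wordsE[OF assms] by blast
  have "\<mu> t $ u = 0"
    by (rule coordinate_zero_on_span[OF _ t]) (use u in auto)
  with u show False by simp
qed

lemma inj_anchor_words:
  fixes \<mu> :: "'t::finite \<Rightarrow> real^'n::finite"
  assumes "anchor_words \<mu>"
  shows "inj \<mu>"
  using assms by (auto simp: anchor_words_def inj_def) (metis less_irrefl)

text \<open>The anchor coordinate of a topic isolates its coefficient, which is therefore
  nonnegative. Adding up all coordinates shows that the coefficients sum to 1.\<close>

lemma simplex_in_span_anchor_words:
  fixes \<mu> :: "'t::finite \<Rightarrow> real^'n::finite"
  assumes "anchor_words \<mu>" "range \<mu> \<subseteq> prob_simplex" "x \<in> prob_simplex" "x \<in> span (range \<mu>)"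
  shows "x \<in> convex hull (range \<mu>)"
proof -
  obtain c where x: "x = (\<Sum>p\<in>range \<mu>. c p *\<^sub>R p)"
    using assms(4) by (auto simp: span_finite)
  have "0 \<le> c (\<mu> t)" for t
  proof -
    obtain u where u: "\<mu> t $ u > 0" "\<And>t'. \<mu> t' \<noteq> \<mu> t \<Longrightarrow> \<mu> t' $ u = 0"
        "\<And>t'. t' \<noteq> t \<Longrightarrow> \<mu> t' $ u = 0"
      using anchor_wordsE[OF assms(1)] by blast
    have "x $ u = (\<Sum>p\<in>range \<mu>. c p * p $ u)"
      by (simp add: x)
    also have "\<dots> = (\<Sum>p\<in>{\<mu> t}. c p * p $ u)"
      by (rule sum.mono_neutral_right) (use u in auto)
    finally show ?thesis
      using assms(3) u by (simp add: prob_simplex_def) (metis linorder_not_le mult_less_0_iff)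
  qed
  moreover have "sum c (range \<mu>) = 1"
  proof -
    have "1 = (\<Sum>u\<in>UNIV. \<Sum>p\<in>range \<mu>. c p * p $ u)"
      using assms(3) by (simp add: prob_simplex_def x)
    also have "\<dots> = (\<Sum>p\<in>range \<mu>. c p * (\<Sum>u\<in>UNIV. p $ u))"
      by (subst sum.swap) (simp add: sum_distrib_left)
    also have "\<dots> = sum c (range \<mu>)"
      by (intro sum.cong refl) (use assms(2) in \<open>auto simp: prob_simplex_def\<close>)
    finally show ?thesis by simp
  qed
  ultimately show ?thesis
    by (auto simp: convex_hull_finite x)
qed

lemma topic_mixture_matrix_row:
  "topic_mixture_matrix \<mu> \<alpha> $ u = (\<Sum>i\<in>UNIV. \<Sum>j\<in>UNIV. (\<alpha> $ i $ j * \<mu> i $ u) *\<^sub>R \<mu> j)"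
  by (simp add: topic_mixture_matrix_def vec_eq_iff)

text \<open>The row at an anchor token of topic \<open>i\<close> is a positive multiple of the
  combination of topics with weights from row \<open>i\<close> of \<open>\<Theta>\<close>. A left
  inverse of \<open>\<Theta>\<close> then recovers the topics.\<close>

lemma topics_in_span:
  fixes \<mu> :: "'t::finite \<Rightarrow> real^'n::finite"
  assumes "anchor_words \<mu>" "inj ((*v) \<Theta>)"
    and row: "\<And>u. topic_mixture_matrix \<mu> \<Theta> $ u \<in> span S"
  shows "range \<mu> \<subseteq> span S"
proof -
  have row': "(\<Sum>j\<in>UNIV. \<Theta> $ i $ j *\<^sub>R \<mu> j) \<in> span S" for i
  proof -
    obtain u where u: "\<mu> i $ u > 0" "\<And>t'. \<mu> t' \<noteq> \<mu> i \<Longrightarrow> \<mu> t' $ u = 0"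
        "\<And>t'. t' \<noteq> i \<Longrightarrow> \<mu> t' $ u = 0"
      using anchor_wordsE[OF assms(1)] by blast
    have "topic_mixture_matrix \<mu> \<Theta> $ u = (\<Sum>i'\<in>{i}. \<Sum>j\<in>UNIV. (\<Theta> $ i' $ j * \<mu> i' $ u) *\<^sub>R \<mu> j)"
      unfolding topic_mixture_matrix_row by (rule sum.mono_neutral_right) (use u in auto)
    also have "\<dots> = \<mu> i $ u *\<^sub>R (\<Sum>j\<in>UNIV. \<Theta> $ i $ j *\<^sub>R \<mu> j)"
      by (simp add: scaleR_sum_right mult.commute)
    finally have "(\<Sum>j\<in>UNIV. \<Theta> $ i $ j *\<^sub>R \<mu> j) = (1 / \<mu> i $ u) *\<^sub>R topic_mixture_matrix \<mu> \<Theta> $ u"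
      using u by simp
    then show ?thesis using row by (simp add: span_scale)
  qed
  obtain B where B: "B ** \<Theta> = mat 1"
    using assms(2) by (auto simp: matrix_left_invertible_injective[symmetric])
  have "\<mu> k \<in> span S" for k
  proof -
    have "\<mu> k = (\<Sum>j\<in>UNIV. (B ** \<Theta>) $ k $ j *\<^sub>R \<mu> j)"
      by (simp add: B mat_def if_distrib[of "\<lambda>r. r *\<^sub>R _"] cong: if_cong)
    also have "\<dots> = (\<Sum>i\<in>UNIV. B $ k $ i *\<^sub>R (\<Sum>j\<in>UNIV. \<Theta> $ i $ j *\<^sub>R \<mu> j))"
      unfolding matrix_matrix_mult_def
      by (simp add: scaleR_sum_right scaleR_sum_left) (rule sum.swap)
    also have "\<dots> \<in> span S"
      by (intro span_sum span_scale row')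
    finally show ?thesis .
  qed
  then show ?thesis by auto
qed

text \<open>The topics are recovered as the extreme points of the polytope cut out of the simplex by the row space.\<close>

lemma topics_identifiable:
  fixes \<mu> \<mu>' :: "'t::finite \<Rightarrow> real^'n::finite"
  assumes "range \<mu> \<subseteq> prob_simplex" "anchor_words \<mu>" "range \<mu>' \<subseteq> prob_simplex" "anchor_words \<mu>'"
    and "inj ((*v) \<Theta>)"
    and eq: "topic_mixture_matrix \<mu> \<Theta> = topic_mixture_matrix \<mu>' \<alpha>"
  shows "range \<mu> = range \<mu>'"
proof -
  have sub: "range \<mu> \<subseteq> span (range \<mu>')"
    by (rule topics_in_span[OF assms(2,5)])
       (unfold eq topic_mixture_matrix_row, intro span_sum span_scale span_base rangeI)
  \<comment> \<open>Dimension count: both families consist of \<open>CARD('t)\<close> independent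
    vectors, so one inclusion of spans gives the other.\<close>
  have "span (range \<mu>') \<subseteq> span (range \<mu>)"
    by (rule card_ge_dim_independent)
       (use sub assms in \<open>auto simp: independent_anchor_words dim_eq_card_independent card_image inj_anchor_words\<close>)
  then have "range \<mu>' \<subseteq> span (range \<mu>)"
    by (meson span_superset order_trans)
  with sub have "range \<mu> \<subseteq> convex hull (range \<mu>')" "range \<mu>' \<subseteq> convex hull (range \<mu>)"
    using assms simplex_in_span_anchor_words by blast+
  then have hull: "convex hull (range \<mu>) = convex hull (range \<mu>')"
    by (meson convex_convex_hull hull_minimal subset_antisym)
  \<comment> \<open>Linear independence gives affine independence, so every topic is a vertex of the
    hull.\<close>
  have ext: "x extreme_point_of (convex hull (range \<nu>)) \<longleftrightarrow> x \<in> range \<nu>"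
    if "anchor_words \<nu>" for \<nu> :: "'t \<Rightarrow> real^'n" and x
    using independent_anchor_words[OF that] affine_dependent_imp_dependent
    by (intro extreme_point_of_convex_hull_affine_independent) blast
  show ?thesis
    using ext[OF assms(2)] ext[OF assms(4)] hull by auto
qed

subsection \<open>The smallest singular value\<close>

lemma inner_transpose_mul_self:
  fixes A :: "real^'n::finite^'m::finite"
  shows "((transpose A ** A) *v x) \<bullet> y = (A *v x) \<bullet> (A *v y)"
  by (simp add: dot_lmul_matrix flip: matrix_vector_mul_assoc)

text \<open>Replaces the \<open>LEAST\<close> of the definition by the minimum \<open>m\<close> of
  \<open>norm (A *v x)\<close> over the unit sphere. The first variation at a minimizer shows that
  it is an eigenvector for \<open>m\<^sup>2\<close>.\<close>

lemma smallest_singular_value_attained: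
  fixes A :: "real^'n::finite^'m::finite"
  obtains x where "norm x = 1" "norm (A *v x) = smallest_singular_value A"
    "\<And>y. smallest_singular_value A * norm y \<le> norm (A *v y)"
proof -
  have cont: "continuous_on (sphere 0 1) (\<lambda>x. norm (A *v x))"
    by (intro continuous_on_norm linear_continuous_on matrix_vector_mul_bounded_linear)
  have ne: "sphere (0::real^'n) 1 \<noteq> {}"
    by (simp add: sphere_eq_empty)
  obtain x where "x \<in> sphere 0 1" "\<forall>y\<in>sphere 0 1. norm (A *v x) \<le> norm (A *v y)"
    using continuous_attains_inf[OF compact_sphere ne cont] by blast
  then have x: "norm x = 1" and min: "\<And>y. norm y = 1 \<Longrightarrow> norm (A *v x) \<le> norm (A *v y)"
    by auto
  define m where "m = norm (A *v x)"
  have m_le: "m * norm y \<le> norm (A *v y)" for y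
  proof (cases "y = 0")
    case False
    then have "m \<le> norm (A *v (y /\<^sub>R norm y))"
      unfolding m_def by (intro min) simp
    also have "\<dots> = norm (A *v y) / norm y"
      by (simp add: matrix_vector_mult_scaleR divide_inverse mult.commute)
    finally show ?thesis using False by (simp add: field_simps)
  qed simp
  \<comment> \<open>The residual of the eigenvector equation, half the gradient of
    \<open>(norm (A *v x))\<^sup>2 - m\<^sup>2 * (norm x)\<^sup>2\<close>.\<close>
  define w where "w = (transpose A ** A) *v x - m\<^sup>2 *s x"
  have inner_w: "w \<bullet> y = (A *v x) \<bullet> (A *v y) - m\<^sup>2 * (x \<bullet> y)" for y
    by (simp add: w_def inner_diff_left scalar_mult_eq_scaleR inner_transpose_mul_self)
  \<comment> \<open>Minimality at \<open>x + t *\<^sub>R w\<close>; the terms constant in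
    \<open>t\<close> cancel.\<close>
  have quad: "0 \<le> 2 * t * (w \<bullet> w) + t\<^sup>2 * ((norm (A *v w))\<^sup>2 - m\<^sup>2 * (norm w)\<^sup>2)" for t
  proof -
    have "(m * norm (x + t *\<^sub>R w))\<^sup>2 \<le> (norm (A *v (x + t *\<^sub>R w)))\<^sup>2"
      by (intro power_mono m_le) (simp add: m_def)
    moreover have "(norm (A *v (x + t *\<^sub>R w)))\<^sup>2
        = m\<^sup>2 + 2 * t * ((A *v x) \<bullet> (A *v w)) + t\<^sup>2 * (norm (A *v w))\<^sup>2"
      unfolding m_def power2_norm_eq_inner matrix_vector_right_distrib matrix_vector_mult_scaleR
      by (simp add: inner_add_left inner_add_right inner_commute power2_eq_square)
    moreover have "(norm (x + t *\<^sub>R w))\<^sup>2 = 1 + 2 * t * (x \<bullet> w) + t\<^sup>2 * (norm w)\<^sup>2"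
      unfolding power2_norm_eq_inner using x
      by (simp add: inner_add_left inner_add_right inner_commute power2_eq_square norm_eq_1)
    ultimately show ?thesis
      by (simp add: inner_w power_mult_distrib algebra_simps)
  qed
  have "w = 0"
  proof (rule ccontr)
    assume "w \<noteq> 0"
    define a c where "a = w \<bullet> w" and "c = (norm (A *v w))\<^sup>2 - m\<^sup>2 * (norm w)\<^sup>2"
    have a: "0 < a" using \<open>w \<noteq> 0\<close> by (simp add: a_def)
    have "(m * norm w)\<^sup>2 \<le> (norm (A *v w))\<^sup>2"
      by (intro power_mono m_le) (simp add: m_def)
    then have c: "0 \<le> c" by (simp add: c_def power_mult_distrib)
    \<comment> \<open>With \<open>t = - e\<close> the linear term \<open>- 2 * e * a\<close>
      outweighs the quadratic term \<open>e\<^sup>2 * c\<close>, because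
      \<open>e * c < a\<close>.\<close>
    define e where "e = a / (c + 1)"
    have e: "0 < e" "e * c < a"
      using a c by (auto simp: e_def field_simps)
    have "0 \<le> e * (e * c - 2 * a)"
      using quad[of "- e"] by (simp add: a_def c_def algebra_simps power2_eq_square)
    also have "\<dots> < 0"
      using a e by (intro mult_pos_neg) auto
    finally show False by simp
  qed
  then have "x \<noteq> 0 \<and> (transpose A ** A) *v x = m\<^sup>2 *s x"
    using x by (auto simp: w_def)
  then have "m \<in> singular_values A"
    unfolding singular_values_def by (auto simp: m_def)
  \<comment> \<open>An eigenvector for \<open>s\<^sup>2\<close> is stretched by exactly
    \<open>s\<close>, so \<open>m_le\<close> applies to it.\<close>
  moreover have "m \<le> s" if "s \<in> singular_values A" for s
  proof -
    from that obtain y where s: "0 \<le> s" "y \<noteq> 0" "(transpose A ** A) *v y = s\<^sup>2 *s y"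
      by (auto simp: singular_values_def)
    have "(norm (A *v y))\<^sup>2 = ((transpose A ** A) *v y) \<bullet> y"
      by (simp add: power2_norm_eq_inner inner_transpose_mul_self)
    also have "\<dots> = (s * norm y)\<^sup>2"
      by (simp add: s scalar_mult_eq_scaleR power_mult_distrib power2_norm_eq_inner)
    finally have "norm (A *v y) = s * norm y"
      using s by (simp add: power2_eq_iff_nonneg)
    then show ?thesis
      using m_le[of y] s by simp
  qed
  ultimately have "smallest_singular_value A = m"
    unfolding smallest_singular_value_def by (intro Least_equality) auto
  then show ?thesis
    using that x m_le by (simp add: m_def)
qed

lemma smallest_singular_value_pos:
  assumes "inj ((*v) A)"
  shows "0 < smallest_singular_value A"
proof -
  obtain x where x: "norm x = 1" "norm (A *v x) = smallest_singular_value A"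
    by (rule smallest_singular_value_attained)
  then have "A *v x \<noteq> 0"
    using assms by (metis injD matrix_vector_mult_0_right norm_zero zero_neq_one)
  then show ?thesis using x by (metis zero_less_norm_iff)
qed

subsection \<open>The gap\<close>

text \<open>A simplex in matrix space, containing both the topic co-occurrence matrices and the
  weights of FDMs; its compactness makes the gap uniform.\<close>

definition weight_matrices :: "(real^'t::finite^'t) set" where
  "weight_matrices = {\<alpha>. (\<forall>i j. 0 \<le> \<alpha> $ i $ j) \<and> (\<Sum>i\<in>UNIV. \<Sum>j\<in>UNIV. \<alpha> $ i $ j) = 1}"

lemma compact_weight_matrices: "compact (weight_matrices :: (real^'t::finite^'t) set)"
proof -
  have "norm \<alpha> \<le> 1" if "\<alpha> \<in> weight_matrices" for \<alpha> :: "real^'t^'t"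
  proof -
    have "norm \<alpha> \<le> (\<Sum>i\<in>UNIV. norm (\<alpha> $ i))"
      unfolding norm_vec_def by (rule L2_set_le_sum) simp
    also have "\<dots> \<le> (\<Sum>i\<in>UNIV. \<Sum>j\<in>UNIV. \<bar>\<alpha> $ i $ j\<bar>)"
      by (intro sum_mono norm_le_l1_cart)
    also have "\<dots> = 1"
      using that by (simp add: weight_matrices_def)
    finally show ?thesis .
  qed
  then have "bounded (weight_matrices :: (real^'t^'t) set)"
    by (auto simp: bounded_iff)
  moreover have "closed (weight_matrices :: (real^'t^'t) set)"
    unfolding weight_matrices_def
    by (intro closed_Collect_conj closed_Collect_all closed_Collect_le closed_Collect_eq continuous_intros)
  ultimately show ?thesis
    by (simp add: compact_eq_bounded_closed)
qed

lemma topic_mixture_matrix_prob: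
  fixes \<mu> :: "'t::finite \<Rightarrow> real^'n::finite"
  assumes "range \<mu> \<subseteq> prob_simplex" "\<alpha> \<in> weight_matrices"
  shows "0 \<le> topic_mixture_matrix \<mu> \<alpha> $ u $ v"
    and "(\<Sum>u\<in>UNIV. \<Sum>v\<in>UNIV. topic_mixture_matrix \<mu> \<alpha> $ u $ v) = 1"
proof -
  have mu: "0 \<le> \<mu> t $ u" "(\<Sum>u\<in>UNIV. \<mu> t $ u) = 1" for t u
    using assms(1) by (auto simp: prob_simplex_def)
  show "0 \<le> topic_mixture_matrix \<mu> \<alpha> $ u $ v"
    using assms(2) by (auto simp: topic_mixture_matrix_def weight_matrices_def intro!: sum_nonneg mult_nonneg_nonneg mu)
  \<comment> \<open>Brings the token sum innermost, where each topic adds up to 1.\<close>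
  have swap: "(\<Sum>u\<in>UNIV. \<Sum>i\<in>UNIV. \<Sum>j\<in>UNIV. h u i j) = (\<Sum>i\<in>UNIV. \<Sum>j\<in>UNIV. \<Sum>u\<in>UNIV. h u i j)"
    for h :: "'n \<Rightarrow> 't \<Rightarrow> 't \<Rightarrow> real"
    by (subst sum.swap, rule sum.cong[OF refl], rule sum.swap)
  have "(\<Sum>v\<in>UNIV. topic_mixture_matrix \<mu> \<alpha> $ u $ v) = (\<Sum>i\<in>UNIV. \<Sum>j\<in>UNIV. \<alpha> $ i $ j * \<mu> i $ u)" for u
    unfolding topic_mixture_matrix_def vec_lambda_beta swap by (simp add: mu flip: sum_distrib_left)
  then have "(\<Sum>u\<in>UNIV. \<Sum>v\<in>UNIV. topic_mixture_matrix \<mu> \<alpha> $ u $ v)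
      = (\<Sum>i\<in>UNIV. \<Sum>j\<in>UNIV. \<Sum>u\<in>UNIV. \<alpha> $ i $ j * \<mu> i $ u)"
    by (simp add: swap)
  then show "(\<Sum>u\<in>UNIV. \<Sum>v\<in>UNIV. topic_mixture_matrix \<mu> \<alpha> $ u $ v) = 1"
    using assms(2) by (simp add: mu weight_matrices_def flip: sum_distrib_left)
qed

text \<open>\<open>sqrt\<close>, extended as an odd function, is injective on the reals, so entries
  that differ contribute a positive square.\<close>

lemma hellinger_pos:
  assumes "A \<noteq> B"
  shows "0 < hellinger A B"
proof -
  obtain u v where "A $ u $ v \<noteq> B $ u $ v"
    using assms by (auto simp: vec_eq_iff)
  then have "0 < (sqrt (A $ u $ v) - sqrt (B $ u $ v))\<^sup>2"
    by simp
  then have "0 < (\<Sum>v\<in>UNIV. (sqrt (A $ u $ v) - sqrt (B $ u $ v))\<^sup>2)"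
    by (rule sum_pos2[where i = v, rotated 2]) simp_all
  then show ?thesis
    unfolding hellinger_def by (rule sum_pos2[where i = u, rotated 2]) (simp_all add: sum_nonneg)
qed

text \<open>A continuous function, positive by \<open>topics_identifiable\<close>, has a positive
  minimum on a compact set of pairs of weights.\<close>

lemma hellinger_gap:
  fixes \<mu> \<mu>' :: "'t::finite \<Rightarrow> real^'n::finite"
  assumes mu: "range \<mu> \<subseteq> prob_simplex" "anchor_words \<mu>" "range \<mu>' \<subseteq> prob_simplex" "anchor_words \<mu>'"
    and ne: "range \<mu>' \<noteq> range \<mu>" and "0 < k"
  obtains g where "0 < g"
    "\<And>\<Theta> \<alpha>. \<Theta> \<in> weight_matrices \<Longrightarrow> smallest_singular_value \<Theta> = k \<Longrightarrow> \<alpha> \<in> weight_matrices \<Longrightarrow>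
       g \<le> hellinger (topic_mixture_matrix \<mu> \<Theta>) (topic_mixture_matrix \<mu>' \<alpha>)"
proof -
  \<comment> \<open>The lower bound for every \<open>x\<close> is a closed condition on
    \<open>\<Theta>\<close>, implies injectivity as \<open>0 < k\<close>, and holds whenever the
    smallest singular value is \<open>k\<close>.\<close>
  define K where "K = weight_matrices \<inter> {\<Theta> :: real^'t^'t. \<forall>x. k * norm x \<le> norm (\<Theta> *v x)}"
  define F where "F = (\<lambda>(\<Theta>, \<alpha>). hellinger (topic_mixture_matrix \<mu> \<Theta>) (topic_mixture_matrix \<mu>' \<alpha>))"
  have "closed {\<Theta> :: real^'t^'t. \<forall>x. k * norm x \<le> norm (\<Theta> *v x)}"
    unfolding matrix_vector_mult_def
    by (intro closed_Collect_all closed_Collect_le continuous_intros)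
  then have comp: "compact (K \<times> (weight_matrices :: (real^'t^'t) set))"
    unfolding K_def by (intro compact_Times compact_Int_closed compact_weight_matrices)
  have cont: "continuous_on (K \<times> weight_matrices) F"
    unfolding F_def hellinger_def topic_mixture_matrix_def split_beta vec_lambda_beta
    by (intro continuous_intros)
  have pos: "0 < F z" if "z \<in> K \<times> weight_matrices" for z
  proof -
    obtain \<Theta> \<alpha> where z: "z = (\<Theta>, \<alpha>)" by (cases z)
    have "inj ((*v) \<Theta>)"
    proof (rule injI)
      fix x y assume "\<Theta> *v x = \<Theta> *v y"
      then have "k * norm (x - y) \<le> 0"
        using that z by (auto simp: K_def dest: spec[of _ "x - y"] simp: matrix_vector_mult_diff_distrib)
      then show "x = y" using \<open>0 < k\<close> by (simp add: mult_le_0_iff)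
    qed
    then have "topic_mixture_matrix \<mu> \<Theta> \<noteq> topic_mixture_matrix \<mu>' \<alpha>"
      using topics_identifiable[OF mu] ne by metis
    then show ?thesis by (simp add: F_def z hellinger_pos)
  qed
  have "\<exists>g>0. \<forall>z\<in>K \<times> weight_matrices. g \<le> F z"
  \<comment> \<open>\<open>K\<close> may be empty for large \<open>k\<close>; then 1 serves as the
    gap.\<close>
  proof (cases "K \<times> (weight_matrices :: (real^'t^'t) set) = {}")
    case True
    then show ?thesis by (metis empty_iff zero_less_one)
  next
    case False
    then show ?thesis using continuous_attains_inf[OF comp False cont] pos by blast
  qed
  then obtain g where g: "0 < g" "\<And>z. z \<in> K \<times> weight_matrices \<Longrightarrow> g \<le> F z" by blast
  show ?thesis
  proof (rule that[OF g(1)])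
    fix \<Theta> \<alpha> :: "real^'t^'t"
    assume *: "\<Theta> \<in> weight_matrices" "smallest_singular_value \<Theta> = k" "\<alpha> \<in> weight_matrices"
    then have "(\<Theta>, \<alpha>) \<in> K \<times> weight_matrices"
      unfolding K_def using smallest_singular_value_attained[of \<Theta>] by auto
    then show "g \<le> hellinger (topic_mixture_matrix \<mu> \<Theta>) (topic_mixture_matrix \<mu>' \<alpha>)"
      using g(2) by (force simp: F_def)
  qed
qed

text \<open>Only finitely many enumerations \<open>\<mu>\<close>, \<open>\<mu>'\<close> of the two sets have to be taken into account.\<close>

lemma hellinger_gap_sets:
  obtains \<gamma> :: "(real^'n::finite) set \<Rightarrow> (real^'n) set \<Rightarrow> real \<Rightarrow> real" where
    "\<And>S S' k. 0 < \<gamma> S S' k"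
    "\<And>(\<mu> :: 't::finite \<Rightarrow> real^'n) (\<mu>' :: 't \<Rightarrow> real^'n) \<Theta> \<alpha>.
       range \<mu> \<subseteq> prob_simplex \<Longrightarrow> anchor_words \<mu> \<Longrightarrow> range \<mu>' \<subseteq> prob_simplex \<Longrightarrow> anchor_words \<mu>' \<Longrightarrow>
       range \<mu>' \<noteq> range \<mu> \<Longrightarrow> \<Theta> \<in> weight_matrices \<Longrightarrow> inj ((*v) \<Theta>) \<Longrightarrow> \<alpha> \<in> weight_matrices \<Longrightarrow>
       \<gamma> (range \<mu>) (range \<mu>') (smallest_singular_value \<Theta>)
         \<le> hellinger (topic_mixture_matrix \<mu> \<Theta>) (topic_mixture_matrix \<mu>' \<alpha>)"
proof -
  define good where "good = (\<lambda>(\<mu> :: 't \<Rightarrow> real^'n) (\<mu>' :: 't \<Rightarrow> real^'n) k. range \<mu> \<subseteq> prob_simplex \<and> anchor_words \<mu> \<and>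
      range \<mu>' \<subseteq> prob_simplex \<and> anchor_words \<mu>' \<and> range \<mu>' \<noteq> range \<mu> \<and> (0::real) < k)"
  define gap where "gap = (\<lambda>(\<mu> :: 't \<Rightarrow> real^'n) (\<mu>' :: 't \<Rightarrow> real^'n) k g. \<forall>\<Theta>\<in>weight_matrices. \<forall>\<alpha>\<in>weight_matrices.
      smallest_singular_value \<Theta> = k \<longrightarrow>
      g \<le> hellinger (topic_mixture_matrix \<mu> \<Theta>) (topic_mixture_matrix \<mu>' \<alpha>))"
  \<comment> \<open>Positivity is demanded outside \<open>good\<close> too, where 1 is the default,
    so that minima over arbitrary enumerations stay positive.\<close>
  have "\<forall>\<mu> \<mu>' k. \<exists>g>0. good \<mu> \<mu>' k \<longrightarrow> gap \<mu> \<mu>' k g"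
  proof (intro allI)
    fix \<mu> \<mu>' k
    show "\<exists>g>0. good \<mu> \<mu>' k \<longrightarrow> gap \<mu> \<mu>' k g"
    proof (cases "good \<mu> \<mu>' k")
      case True
      then have "range \<mu> \<subseteq> prob_simplex" "anchor_words \<mu>" "range \<mu>' \<subseteq> prob_simplex" "anchor_words \<mu>'"
        "range \<mu>' \<noteq> range \<mu>" "0 < k"
        by (auto simp: good_def)
      then obtain g where "0 < g" "gap \<mu> \<mu>' k g"
        unfolding gap_def by (rule hellinger_gap) blast
      then show ?thesis by blast
    qed (auto intro: exI[of _ 1])
  qed
  then obtain g where g: "\<And>\<mu> \<mu>' k. 0 < g \<mu> \<mu>' k" "\<And>\<mu> \<mu>' k. good \<mu> \<mu>' k \<Longrightarrow> gap \<mu> \<mu>' k (g \<mu> \<mu>' k)"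
    by metis
  define E where "E = (\<lambda>S. {\<mu> :: 't \<Rightarrow> real^'n. range \<mu> = S})"
  have fin: "finite (E S)" for S
  proof (cases "finite S")
    case True
    have "E S \<subseteq> {\<mu>. \<forall>t. (t \<in> UNIV \<longrightarrow> \<mu> t \<in> S) \<and> (t \<notin> UNIV \<longrightarrow> \<mu> t = 0)}"
      by (auto simp: E_def)
    then show ?thesis
      using finite_set_of_finite_funs[OF finite_class.finite_UNIV True] by (rule finite_subset)
  next
    case False
    then have "E S = {}" by (auto simp: E_def)
    then show ?thesis by simp
  qed
  \<comment> \<open>All gaps over enumerations of the two sets. Their minimum depends on the sets
    only; the element 1 covers sets without an enumeration.\<close>
  define V where "V = (\<lambda>S S' k. insert 1 ((\<lambda>(\<mu>, \<mu>'). g \<mu> \<mu>' k) ` (E S \<times> E S')))"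
  have V: "finite (V S S' k)" "V S S' k \<noteq> {}" for S S' k
    by (auto simp: V_def fin)
  show ?thesis
  proof (rule that[of "\<lambda>S S' k. Min (V S S' k)"])
    show "0 < Min (V S S' k)" for S S' k
      using V g(1) by (subst Min_gr_iff) (auto simp: V_def)
    fix \<mu> \<mu>' :: "'t \<Rightarrow> real^'n" and \<Theta> \<alpha> :: "real^'t^'t"
    let ?k = "smallest_singular_value \<Theta>"
    assume *: "range \<mu> \<subseteq> prob_simplex" "anchor_words \<mu>" "range \<mu>' \<subseteq> prob_simplex" "anchor_words \<mu>'"
       "range \<mu>' \<noteq> range \<mu>" "\<Theta> \<in> weight_matrices" "inj ((*v) \<Theta>)" "\<alpha> \<in> weight_matrices"
    have "Min (V (range \<mu>) (range \<mu>') ?k) \<le> g \<mu> \<mu>' ?k"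
      by (rule Min_le[OF V(1)]) (auto simp: V_def E_def)
    also have "gap \<mu> \<mu>' ?k (g \<mu> \<mu>' ?k)"
      using * smallest_singular_value_pos by (intro g(2)) (auto simp: good_def)
    then have "g \<mu> \<mu>' ?k \<le> hellinger (topic_mixture_matrix \<mu> \<Theta>) (topic_mixture_matrix \<mu>' \<alpha>)"
      using * by (auto simp: gap_def)
    finally show "Min (V (range \<mu>) (range \<mu>') ?k)
        \<le> hellinger (topic_mixture_matrix \<mu> \<Theta>) (topic_mixture_matrix \<mu>' \<alpha>)" .
  qed
qed

subsection \<open>A strong law for bounded variables\<close>

text \<open>Only the means are assumed equal, because documents of different lengths have different
  laws.\<close>

lemma (in prob_space) strong_law_bounded:
  fixes X :: "nat \<Rightarrow> 'a \<Rightarrow> real"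
  assumes indep: "indep_vars (\<lambda>_. borel) X UNIV"
    and bounds: "\<And>d. AE x in M. X d x \<in> {0..1}"
    and mean: "\<And>d. expectation (X d) = m"
  shows "AE x in M. (\<lambda>n. (\<Sum>d<n. X d x) / real n) \<longlonglongrightarrow> m"
proof -
  have rv [measurable]: "random_variable borel (X d)" for d
    using indep by (auto simp: indep_vars_def)
  have ev: "AE x in M. \<forall>\<^sub>F n in sequentially. \<bar>(\<Sum>d<n. X d x) / real n - m\<bar> < e" if "0 < e" for e
  proof -
    define A where "A = (\<lambda>n. {x \<in> space M. \<bar>(\<Sum>d<n. X d x) - real n * m\<bar> \<ge> e * real n})"
    have [measurable]: "A n \<in> sets M" for n
      unfolding A_def by measurable
    have bound: "prob (A n) \<le> 2 * exp (- 2 * e\<^sup>2) ^ n" for n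
    proof (cases "n = 0")
      case True
      then show ?thesis using prob_le_1[of "A 0"] by (simp del: prob_le_1)
    next
      case False
      interpret Hoeffding_ineq M "{..<n}" X "\<lambda>_. 0" "\<lambda>_. 1" "\<Sum>d<n. expectation (X d)"
        by unfold_locales (use bounds indep in \<open>auto intro: indep_vars_subset\<close>)
      have "prob (A n) \<le> 2 * exp (- 2 * (e * real n)\<^sup>2 / real n)"
        using Hoeffding_ineq_abs_ge[of "e * real n"] False that by (simp add: A_def mean)
      \<comment> \<open>The squared ranges add up to \<open>n\<close>, so the exponent is linear in
        \<open>n\<close> and the bound is geometric, hence summable.\<close>
      also have "- 2 * (e * real n)\<^sup>2 / real n = real n * (- 2 * e\<^sup>2)"
        using False by (simp add: power2_eq_square)
      finally show ?thesis
        by (simp only: exp_of_nat_mult)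
    qed
    have "summable (\<lambda>n. 2 * exp (- 2 * e\<^sup>2) ^ n)"
      using that by (intro summable_mult summable_geometric) simp
    then have "summable (\<lambda>n. prob (A n))"
      by (rule summable_comparison_test') (use bound in auto)
    then have "AE x in M. \<forall>\<^sub>F n in sequentially. x \<in> space M - A n"
      by (intro borel_cantelli_AE1) (auto simp: less_top[symmetric])
    then show ?thesis
    proof eventually_elim
      case (elim x)
      show ?case
        using elim eventually_gt_at_top[of 0]
      proof eventually_elim
        case (elim n)
        then have "\<bar>(\<Sum>d<n. X d x) - real n * m\<bar> < e * real n"
          by (auto simp: A_def)
        moreover have "\<bar>(\<Sum>d<n. X d x) / real n - m\<bar> = \<bar>(\<Sum>d<n. X d x) - real n * m\<bar> / real n"
          using elim by (simp add: field_simps flip: abs_div_pos)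
        ultimately show ?case
          using elim by (simp add: divide_less_eq)
      qed
    qed
  qed
  \<comment> \<open>Countably many tolerances suffice, and a countable union of null sets is
    null.\<close>
  have "AE x in M. \<forall>k. \<forall>\<^sub>F n in sequentially. \<bar>(\<Sum>d<n. X d x) / real n - m\<bar> < inverse (real (Suc k))"
    unfolding AE_all_countable by (intro allI ev) simp
  then show ?thesis
  proof eventually_elim
    case (elim x)
    show ?case
      unfolding tendsto_iff dist_real_def
    proof (intro allI impI)
      fix e :: real
      assume "0 < e"
      then obtain k where k: "inverse (real (Suc k)) < e"
        using reals_Archimedean by auto
      show "\<forall>\<^sub>F n in sequentially. \<bar>(\<Sum>d<n. X d x) / real n - m\<bar> < e"
        using elim[rule_format, of k] by eventually_elim (use k in simp)
    qed
  qed
qed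

subsection \<open>The mean of a document matrix\<close>

text \<open>The number of ordered pairs of distinct positions of a document carrying the tokens \<open>u\<close> and \<open>v\<close>.\<close>

definition pair_count :: "'a \<Rightarrow> 'a \<Rightarrow> 'a list \<Rightarrow> real" where
  "pair_count u v xs = real (count_list xs u) * real (count_list xs v)
     - (if u = v then real (count_list xs u) else 0)"

lemma pair_count_Nil: "pair_count u v [] = 0"
  by (simp add: pair_count_def)

text \<open>The new position pairs with every old one in both orders.\<close>

lemma pair_count_Cons:
  "pair_count u v (x # xs) = pair_count u v xs
     + (if x = u then 1 else 0) * real (count_list xs v) + (if x = v then 1 else 0) * real (count_list xs u)"
  by (auto simp: pair_count_def algebra_simps)

lemma doc_matrix_pair_count:
  "doc_matrix xs $ u $ v = pair_count u v xs / (real (length xs) * (real (length xs) - 1))"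
proof (cases "length xs \<le> 1")
  \<comment> \<open>Here \<open>l * (l - 1) = 0\<close>, and both sides are 0 because division by
    zero gives 0.\<close>
  case True
  then show ?thesis by (cases xs) (auto simp: doc_matrix_def pair_count_def)
next
  case False
  define l where "l = real (length xs)"
  have "l \<noteq> 0" "l - 1 \<noteq> 0" using False by (auto simp: l_def)
  then have "l / (l - 1) * (a / l) * (b / l) = a * b / (l * (l - 1))"
    "l / (l - 1) * (a\<^sup>2 / l\<^sup>2) - a / (l * (l - 1)) = (a * a - a) / (l * (l - 1))" for a b
    by (simp_all add: power2_eq_square diff_divide_distrib)
  then show ?thesis
    by (simp add: doc_matrix_def pair_count_def Let_def flip: l_def)
qed

text \<open>A new position adds at most \<open>2 * n\<close> pairs to a list of length
  \<open>n\<close>, which is the increment of \<open>n * (n - 1)\<close>.\<close>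

lemma pair_count_bounds:
  "0 \<le> pair_count u v xs \<and> pair_count u v xs \<le> real (length xs) * (real (length xs) - 1)"
proof (induction xs)
  case (Cons x xs)
  have le: "real (count_list xs w) \<le> real (length xs)" for w
    by (simp add: count_le_length)
  have "(if x = u then 1 else 0) * real (count_list xs v) \<le> real (length xs)"
    "(if x = v then 1 else 0) * real (count_list xs u) \<le> real (length xs)"
    using le by auto
  with Cons show ?case
    by (auto simp: pair_count_Cons algebra_simps)
qed (simp add: pair_count_Nil)

lemma doc_matrix_bounds: "doc_matrix xs $ u $ v \<in> {0..1}"
proof (cases "length xs \<le> 1")
  case True
  then show ?thesis by (cases xs) (auto simp: doc_matrix_pair_count)
next
  case False
  then have "0 < real (length xs) * (real (length xs) - 1)" by (intro mult_pos_pos) auto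
  then show ?thesis
    using pair_count_bounds[of u v xs] by (simp add: doc_matrix_pair_count divide_le_eq)
qed

text \<open>Conditioning on the first token, the recursion behind the two expectations computed
  below.\<close>

lemma expectation_replicate_pmf_Suc:
  fixes p :: "'a::finite pmf" and h :: "'a list \<Rightarrow> real"
  shows "measure_pmf.expectation (replicate_pmf (Suc n) p) h
    = (\<Sum>x\<in>UNIV. pmf p x * measure_pmf.expectation (replicate_pmf n p) (\<lambda>xs. h (x # xs)))"
proof -
  have "finite (set_pmf (replicate_pmf n p))"
    using finite_lists_length_eq[of "UNIV :: 'a set" n] by (rule finite_subset[rotated]) (auto simp: set_replicate_pmf)
  then show ?thesis
    by (simp add: pmf_expectation_bind[of UNIV] map_pmf_def[symmetric])
qed

lemma integrable_replicate_pmf: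
  fixes p :: "'a::finite pmf" and h :: "'a list \<Rightarrow> real"
  shows "integrable (replicate_pmf n p) h"
proof -
  have "finite (set_pmf (replicate_pmf n p))"
    using finite_lists_length_eq[of "UNIV :: 'a set" n] by (rule finite_subset[rotated]) (auto simp: set_replicate_pmf)
  then show ?thesis by (rule integrable_measure_pmf_finite)
qed

lemma sum_pmf_mult_eq:
  fixes p :: "'a::finite pmf"
  shows "(\<Sum>x\<in>UNIV. pmf p x * (a + (if x = u then 1 else 0) * b + (if x = v then 1 else 0) * c))
     = a + pmf p u * b + pmf p v * c"
proof -
  have "(\<Sum>x\<in>UNIV. pmf p x) = 1"
    by (simp add: sum_pmf_eq_1)
  then show ?thesis
    by (simp add: distrib_left sum.distrib mult.assoc[symmetric] if_distrib[of "\<lambda>r. _ * r"]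
        flip: sum_distrib_right cong: if_cong)
qed

lemma expectation_count_list:
  fixes p :: "'a::finite pmf"
  shows "measure_pmf.expectation (replicate_pmf n p) (\<lambda>xs. real (count_list xs u)) = real n * pmf p u"
proof (induction n)
  case (Suc n)
  \<comment> \<open>The summand with factor 0 pads the expression to the shape of
    \<open>sum_pmf_mult_eq\<close>.\<close>
  have "measure_pmf.expectation (replicate_pmf n p) (\<lambda>xs. real (count_list (x # xs) u))
     = real n * pmf p u + (if x = u then 1 else 0) * 1 + (if x = u then 1 else 0) * 0" for x
    by (auto simp: Suc.IH[symmetric] integrable_replicate_pmf)
  then show ?case
    unfolding expectation_replicate_pmf_Suc by (simp only: sum_pmf_mult_eq) (simp add: algebra_simps)
qed simp

text \<open>There are \<open>n * (n - 1)\<close> ordered pairs of distinct positions, and the tokens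
  at such a pair are independent.\<close>

lemma expectation_pair_count:
  fixes p :: "'a::finite pmf"
  shows "measure_pmf.expectation (replicate_pmf n p) (pair_count u v)
    = real n * (real n - 1) * (pmf p u * pmf p v)"
proof (induction n)
  case 0
  then show ?case by (simp add: pair_count_Nil)
next
  case (Suc n)
  have "measure_pmf.expectation (replicate_pmf n p) (\<lambda>xs. pair_count u v (x # xs))
     = real n * (real n - 1) * (pmf p u * pmf p v) + (if x = u then 1 else 0) * (real n * pmf p v)
       + (if x = v then 1 else 0) * (real n * pmf p u)" for x
    unfolding pair_count_Cons Suc.IH[symmetric] expectation_count_list[symmetric]
    by (simp add: integrable_replicate_pmf)
  then show ?case
    unfolding expectation_replicate_pmf_Suc by (simp only: sum_pmf_mult_eq) (simp add: algebra_simps)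
qed

lemma expectation_doc_matrix_replicate_pmf:
  fixes p :: "'n::finite pmf"
  assumes "2 \<le> l"
  shows "measure_pmf.expectation (replicate_pmf l p) (\<lambda>xs. doc_matrix xs $ u $ v) = pmf p u * pmf p v"
proof -
  \<comment> \<open>The length is almost surely \<open>l\<close>, so the normalization is
    constant.\<close>
  have "measure_pmf.expectation (replicate_pmf l p) (\<lambda>xs. doc_matrix xs $ u $ v)
      = measure_pmf.expectation (replicate_pmf l p) (\<lambda>xs. pair_count u v xs / (real l * (real l - 1)))"
    by (intro integral_cong_AE) (auto simp: AE_measure_pmf_iff set_replicate_pmf doc_matrix_pair_count)
  also have "\<dots> = pmf p u * pmf p v"
    using assms by (simp add: expectation_pair_count)
  finally show ?thesis .
qed

section \<open>Second moments of the topic weights and the mean under the document law\<close>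

lemma borel_measurable_weight:
  assumes "weight_distribution \<T>"
  shows "(\<lambda>\<theta>. \<theta> $ t) \<in> borel_measurable \<T>"
proof -
  have "(\<lambda>\<theta>. \<theta> $ t) \<in> borel_measurable (restrict_space borel prob_simplex)"
    by (intro measurable_restrict_space1 borel_measurable_continuous_onI continuous_intros)
  then show ?thesis
    using assms measurable_cong_sets[of \<T> "restrict_space borel prob_simplex" borel borel]
    by (auto simp: weight_distribution_def)
qed

lemma prob_simplex_le_1: "\<theta> \<in> prob_simplex \<Longrightarrow> \<theta> $ t \<le> 1"
  using member_le_sum[of t UNIV "\<lambda>t. \<theta> $ t"] by (auto simp: prob_simplex_def)

lemma integrable_weight_product:
  assumes "weight_distribution \<T>"
  shows "integrable \<T> (\<lambda>\<theta>. \<theta> $ i * \<theta> $ j)"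
proof -
  interpret prob_space \<T> using assms by (simp add: weight_distribution_def)
  have "norm (\<theta> $ i * \<theta> $ j) \<le> 1" if "\<theta> \<in> prob_simplex" for \<theta> :: "real^'a"
    using that prob_simplex_le_1[of \<theta>] by (auto simp: prob_simplex_def abs_mult intro!: mult_le_one)
  then show ?thesis
    using borel_measurable_weight[OF assms]
    by (intro integrable_const_bound[where B = 1] AE_I2 borel_measurable_times)
       (auto simp: space_weight_distribution[OF assms])
qed

lemma topic_cooccurrence_nonneg_sum:
  assumes "weight_distribution \<T>"
  shows "0 \<le> topic_cooccurrence \<T> $ i $ j"
    and "(\<Sum>i\<in>UNIV. \<Sum>j\<in>UNIV. topic_cooccurrence \<T> $ i $ j) = 1"
proof -
  interpret prob_space \<T> using assms by (simp add: weight_distribution_def)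
  show "0 \<le> topic_cooccurrence \<T> $ i $ j"
    by (auto simp: topic_cooccurrence_def space_weight_distribution[OF assms] prob_simplex_def
        intro!: integral_nonneg_AE AE_I2 mult_nonneg_nonneg)
  have "(\<Sum>i\<in>UNIV. \<Sum>j\<in>UNIV. topic_cooccurrence \<T> $ i $ j) = (\<integral>\<theta>. (\<Sum>i\<in>UNIV. \<Sum>j\<in>UNIV. \<theta> $ i * \<theta> $ j) \<partial>\<T>)"
    by (simp add: topic_cooccurrence_def integrable_weight_product[OF assms])
  \<comment> \<open>The double sum is the square of the total weight, which is 1 on the
    simplex.\<close>
  also have "\<dots> = (\<integral>\<theta>. 1 \<partial>\<T>)"
    by (intro Bochner_Integration.integral_cong refl)
       (simp add: space_weight_distribution[OF assms] prob_simplex_def flip: sum_product)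
  finally show "(\<Sum>i\<in>UNIV. \<Sum>j\<in>UNIV. topic_cooccurrence \<T> $ i $ j) = 1"
    by (simp add: prob_space)
qed

lemma expectation_doc_matrix:
  fixes \<mu> :: "'t::finite \<Rightarrow> real^'n::finite"
  assumes "range \<mu> \<subseteq> prob_simplex" "weight_distribution \<T>" "2 \<le> l"
  shows "(\<integral>xs. doc_matrix xs $ u $ v \<partial>document_law \<mu> \<T> l)
    = topic_mixture_matrix \<mu> (topic_cooccurrence \<T>) $ u $ v"
proof -
  interpret prob_space \<T> using assms by (simp add: weight_distribution_def)
  \<comment> \<open>Conditioning on \<open>\<theta>\<close>: \<open>B\<close> bounds the matrix
    entries, \<open>B'\<close> the mass of the conditional laws.\<close>
  have "(\<integral>xs. doc_matrix xs $ u $ v \<partial>document_law \<mu> \<T> l)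
      = (\<integral>\<theta>. measure_pmf.expectation (replicate_pmf l (token_pmf \<mu> \<theta>)) (\<lambda>xs. doc_matrix xs $ u $ v) \<partial>\<T>)"
    unfolding document_law_def
    by (rule integral_bind[where K = "count_space UNIV" and B = 1 and B' = 1])
       (use doc_matrix_bounds[of _ u v] measurable_document_kernel[OF assms(1,2)] finite_measure_axioms in
        \<open>auto simp: measure_pmf.emeasure_space_1\<close>)
  also have "\<dots> = (\<integral>\<theta>. (\<Sum>i\<in>UNIV. \<Sum>j\<in>UNIV. \<theta> $ i * \<theta> $ j * (\<mu> i $ u * \<mu> j $ v)) \<partial>\<T>)"
    by (intro Bochner_Integration.integral_cong refl)
       (simp add: expectation_doc_matrix_replicate_pmf[OF assms(3)] pmf_token_pmf[OF assms(1)]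
          space_weight_distribution[OF assms(2)] sum_product mult_ac)
  also have "\<dots> = (\<Sum>i\<in>UNIV. \<Sum>j\<in>UNIV. topic_cooccurrence \<T> $ i $ j * (\<mu> i $ u * \<mu> j $ v))"
    by (simp add: topic_cooccurrence_def integrable_weight_product[OF assms(2)])
  finally show ?thesis
    by (simp add: topic_mixture_matrix_def mult.assoc)
qed

text \<open>The second conjunct supplies the exact zeros that \<open>tendsto_log_score\<close> asks
  for: nonnegative entries with mean 0 vanish almost surely, simultaneously for all
  documents.\<close>

lemma AE_empirical_matrix:
  fixes \<mu> :: "'t::finite \<Rightarrow> real^'n::finite"
  assumes "range \<mu> \<subseteq> prob_simplex" "weight_distribution \<T>" "\<And>d. 2 \<le> l d"
  defines "M \<equiv> topic_mixture_matrix \<mu> (topic_cooccurrence \<T>)"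
  shows "AE docs in corpus_law \<mu> \<T> l. \<forall>u v.
      (\<lambda>D. empirical_matrix docs D $ u $ v) \<longlonglongrightarrow> M $ u $ v \<and>
      (M $ u $ v = 0 \<longrightarrow> (\<forall>D. empirical_matrix docs D $ u $ v = 0))"
proof -
  let ?L = "\<lambda>d. document_law \<mu> \<T> (l d)"
  note ps = prob_space_document_law[OF assms(1,2)]
  interpret product_prob_space ?L UNIV
    by (intro product_prob_spaceI ps)
  have sets: "sets (?L d) = sets (count_space UNIV)" for d
    by (simp add: sets_document_law[OF assms(1,2)])
  have meas: "(\<lambda>xs. doc_matrix xs $ u $ v) \<in> borel_measurable (?L d)" for u v d
    by (simp add: measurable_cong_sets[OF sets refl])
  define X where "X = (\<lambda>u v (d :: nat) docs. doc_matrix (docs d :: 'n list) $ u $ v)"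
  have rv: "X u v d \<in> borel_measurable (corpus_law \<mu> \<T> l)" for u v d
    unfolding X_def corpus_law_def by (rule measurable_compose[where f = "\<lambda>docs. docs d", OF measurable_component_singleton meas]) simp
  have mean: "(\<integral>docs. X u v d docs \<partial>corpus_law \<mu> \<T> l) = M $ u $ v" for u v d
  proof -
    have "M $ u $ v = (\<integral>xs. doc_matrix xs $ u $ v \<partial>distr (corpus_law \<mu> \<T> l) (?L d) (\<lambda>docs. docs d))"
      unfolding corpus_law_def
      by (subst distr_PiM_component) (use ps assms in \<open>auto simp: M_def expectation_doc_matrix\<close>)
    also have "\<dots> = (\<integral>docs. X u v d docs \<partial>corpus_law \<mu> \<T> l)"
      unfolding X_def corpus_law_def by (intro integral_distr meas) simp
    finally show ?thesis by simp
  qed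
  interpret C: prob_space "corpus_law \<mu> \<T> l"
    unfolding corpus_law_def by (rule prob_space_axioms)
  have indep: "C.indep_vars (\<lambda>_. borel) (X u v) UNIV" for u v
  proof -
    \<comment> \<open>The joint law of the coordinates is the law of the identity map, which is the
      product measure itself.\<close>
    have "C.indep_vars ?L (\<lambda>d docs. docs d) UNIV"
      unfolding corpus_law_def
      by (subst C.indep_vars_iff_distr_eq_PiM'[unfolded corpus_law_def])
         (auto simp: distr_PiM_component[OF ps] distr_id2 restrict_def)
    then show ?thesis
      unfolding X_def by (rule C.indep_vars_compose2) (rule meas)
  qed
  have lim: "AE docs in corpus_law \<mu> \<T> l. (\<lambda>D. (\<Sum>d<D. X u v d docs) / real D) \<longlonglongrightarrow> M $ u $ v" for u v
    by (intro C.strong_law_bounded indep mean AE_I2) (unfold X_def, rule doc_matrix_bounds)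
  have zero: "AE docs in corpus_law \<mu> \<T> l. M $ u $ v = 0 \<longrightarrow> (\<forall>d. X u v d docs = 0)" for u v
  proof (cases "M $ u $ v = 0")
    case True
    have "AE docs in corpus_law \<mu> \<T> l. X u v d docs = 0" for d
    proof (subst integral_nonneg_eq_0_iff_AE[symmetric])
      show "integrable (corpus_law \<mu> \<T> l) (X u v d)"
        using doc_matrix_bounds[of _ u v] rv
        by (intro C.integrable_const_bound[where B = 1] AE_I2) (auto simp: X_def)
      show "AE docs in corpus_law \<mu> \<T> l. 0 \<le> X u v d docs"
        using doc_matrix_bounds[of _ u v] by (intro AE_I2) (auto simp: X_def)
    qed (use True mean in simp)
    then show ?thesis by (simp add: AE_all_countable)
  qed simp
  have "AE docs in corpus_law \<mu> \<T> l. \<forall>u v. (\<lambda>D. (\<Sum>d<D. X u v d docs) / real D) \<longlonglongrightarrow> M $ u $ v \<and>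
      (M $ u $ v = 0 \<longrightarrow> (\<forall>d. X u v d docs = 0))"
    unfolding AE_all_countable by (intro allI AE_conjI lim zero)
  then show ?thesis
    by (rule eventually_mono) (auto simp: empirical_matrix_def X_def sum_component)
qed

subsection \<open>The limit of the score\<close>

lemma AE_tendsto_log_score:
  fixes \<mu> :: "'t::finite \<Rightarrow> real^'n::finite"
  assumes "range \<mu> \<subseteq> prob_simplex" "weight_distribution \<T>" "\<And>d. 2 \<le> l d"
  shows "AE docs in corpus_law \<mu> \<T> l. (\<lambda>D. log_score (empirical_matrix docs D) B)
      \<longlonglongrightarrow> log_score (topic_mixture_matrix \<mu> (topic_cooccurrence \<T>)) B"
  using AE_empirical_matrix[OF assms] by eventually_elim (rule tendsto_log_score, auto)

lemma topic_cooccurrence_weight_matrices: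
  "weight_distribution \<T> \<Longrightarrow> topic_cooccurrence \<T> \<in> weight_matrices"
  by (simp add: weight_matrices_def topic_cooccurrence_nonneg_sum)

text \<open>Choosing \<open>\<gamma>\<close> before the topics, the weight law and the lengths
  expresses that it depends on its three arguments alone. Existence of the limit \<open>L\<close> is
  part of the claim.\<close>

theorem theorem4p2:
  "\<exists>\<gamma> :: (real^'n::finite) set \<Rightarrow> (real^'n) set \<Rightarrow> real \<Rightarrow> real.
     \<forall>(\<mu> :: 't::finite \<Rightarrow> real^'n) (\<T> :: (real^'t) measure) (l :: nat \<Rightarrow> nat).
       range \<mu> \<subseteq> prob_simplex \<and> anchor_words \<mu> \<and>
       weight_distribution \<T> \<and> rank (topic_cooccurrence \<T>) = CARD('t) \<and>
       (\<forall>d. 2 \<le> l d) \<longrightarrow>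
       (let M = topic_mixture_matrix \<mu> (topic_cooccurrence \<T>) in
        (AE docs in corpus_law \<mu> \<T> l.
           (\<lambda>D. log_score (empirical_matrix docs D) M) \<longlonglongrightarrow> log_score M M) \<and>
        (\<forall>\<mu>' :: 't \<Rightarrow> real^'n.
           range \<mu>' \<subseteq> prob_simplex \<and> anchor_words \<mu>' \<and> range \<mu>' \<noteq> range \<mu> \<longrightarrow>
           0 < \<gamma> (range \<mu>) (range \<mu>') (smallest_singular_value (topic_cooccurrence \<T>)) \<and>
           (\<forall>M'. is_FDM \<mu>' M' \<longrightarrow>
              (AE docs in corpus_law \<mu> \<T> l.
                 \<exists>L. (\<lambda>D. log_score (empirical_matrix docs D) M') \<longlonglongrightarrow> L \<and>
                     L \<le> log_score M M
                       - ereal (\<gamma> (range \<mu>) (range \<mu>')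
                                  (smallest_singular_value (topic_cooccurrence \<T>)))))))"
proof -
  obtain \<gamma> :: "(real^'n) set \<Rightarrow> (real^'n) set \<Rightarrow> real \<Rightarrow> real" where
    pos: "\<And>S S' k. 0 < \<gamma> S S' k"
    and gap: "\<And>(\<mu> :: 't \<Rightarrow> real^'n) (\<mu>' :: 't \<Rightarrow> real^'n) \<Theta> \<alpha>.
       range \<mu> \<subseteq> prob_simplex \<Longrightarrow> anchor_words \<mu> \<Longrightarrow> range \<mu>' \<subseteq> prob_simplex \<Longrightarrow> anchor_words \<mu>' \<Longrightarrow>
       range \<mu>' \<noteq> range \<mu> \<Longrightarrow> \<Theta> \<in> weight_matrices \<Longrightarrow> inj ((*v) \<Theta>) \<Longrightarrow> \<alpha> \<in> weight_matrices \<Longrightarrow>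
       \<gamma> (range \<mu>) (range \<mu>') (smallest_singular_value \<Theta>)
         \<le> hellinger (topic_mixture_matrix \<mu> \<Theta>) (topic_mixture_matrix \<mu>' \<alpha>)"
    by (rule hellinger_gap_sets[where 'n = 'n and 't = 't]) blast
  show ?thesis
  proof (rule exI[of _ \<gamma>], intro allI impI, unfold Let_def, intro conjI allI impI)
    fix \<mu> :: "'t \<Rightarrow> real^'n" and \<T> :: "(real^'t) measure" and l :: "nat \<Rightarrow> nat"
    let ?\<Theta> = "topic_cooccurrence \<T>"
    let ?M = "topic_mixture_matrix \<mu> ?\<Theta>"
    assume *: "range \<mu> \<subseteq> prob_simplex \<and> anchor_words \<mu> \<and> weight_distribution \<T> \<and>
       rank ?\<Theta> = CARD('t) \<and> (\<forall>d. 2 \<le> l d)"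
    have lim: "AE docs in corpus_law \<mu> \<T> l. (\<lambda>D. log_score (empirical_matrix docs D) B) \<longlonglongrightarrow> log_score ?M B" for B
      using * by (intro AE_tendsto_log_score) auto
    show "AE docs in corpus_law \<mu> \<T> l. (\<lambda>D. log_score (empirical_matrix docs D) ?M) \<longlonglongrightarrow> log_score ?M ?M"
      by (rule lim)
    fix \<mu>' :: "'t \<Rightarrow> real^'n"
    assume **: "range \<mu>' \<subseteq> prob_simplex \<and> anchor_words \<mu>' \<and> range \<mu>' \<noteq> range \<mu>"
    let ?g = "\<gamma> (range \<mu>) (range \<mu>') (smallest_singular_value ?\<Theta>)"
    show "0 < ?g" by (rule pos)
    fix M'
    assume "is_FDM \<mu>' M'"
    then obtain \<alpha> where \<alpha>: "\<alpha> \<in> weight_matrices" "M' = topic_mixture_matrix \<mu>' \<alpha>"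
      by (auto simp: is_FDM_def weight_matrices_def)
    have \<Theta>: "?\<Theta> \<in> weight_matrices" "inj ((*v) ?\<Theta>)"
      using * by (simp_all add: topic_cooccurrence_weight_matrices flip: full_rank_injective)
    \<comment> \<open>The gap is a deterministic inequality for the limit
      \<open>log_score ?M M'\<close>; randomness enters only through \<open>lim\<close>.\<close>
    have "log_score ?M M' \<le> log_score ?M ?M - ereal (hellinger ?M M')"
      unfolding \<alpha>(2) using * ** \<alpha>(1) \<Theta>(1) by (intro log_score_le topic_mixture_matrix_prob) auto
    also have "?g \<le> hellinger ?M M'"
      unfolding \<alpha>(2) using * ** \<alpha>(1) \<Theta> by (intro gap) simp_all
    then have "log_score ?M ?M - ereal (hellinger ?M M') \<le> log_score ?M ?M - ereal ?g"
      by (intro ereal_minus_mono) simp_all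
    finally show "AE docs in corpus_law \<mu> \<T> l. \<exists>L. (\<lambda>D. log_score (empirical_matrix docs D) M') \<longlonglongrightarrow> L \<and>
        L \<le> log_score ?M ?M - ereal ?g"
      using lim[of M'] by (auto elim!: eventually_mono)
  qed
qed

end
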